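(* There is an online algorithm with advice for the proportional removable knapsack problem \textsc{RemKnap} that reads two advice bits and is strictly $4/3$-competitive.
   Context: \textsc{RemKnap} (proportional removable knapsack) is the following online maximization problem. An instance is a sequence of items $1,\dots,n$ with sizes $s_1,\dots,s_n\in\mathbb{R}_{>0}$; the knapsack has capacity $1$. For a set $A$ of items, $s(A)=\sum_{i\in A}s_i$. The items are revealed one by one; the algorithm starts with the empty packing $A_0=\emptyset$, and when item $i$ is revealed (and only then does it learn $s_i$) it must choose a new packing $A_i\subseteq A_{i-1}\cup\{i\}$ with $s(A_i)\le 1$. Thus it may remove any previously packed items and may pack the new item, but a removed or rejected item can never be packed again. The algorithm learns $n$ only after choosing $A_n$. The gain is $\mathrm{ALG}(I)=s(A_n)$; $\mathrm{OPT}(I)$ is the maximum of $s(A)$ over all subsets $A$ of the items with $s(A)\le1$. In the advice model, an omniscient oracle that knows the whole instance writes a binary advice string that the algorithm may read. An algorithm is strictly $\rho$-competitive if $\mathrm{OPT}(I)/\mathrm{ALG}(I)\le\rho$ for every instance $I$. *)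

theory Defs
  imports Complex_Main
begin

(* An instance is the list of item sizes in order of arrival; item i (counted
   from 0) has size I ! i.  Sizes above the capacity 1 are allowed. *)
type_synonym inst = "real list"

definition valid_inst :: "inst \<Rightarrow> bool" where
  "valid_inst I \<longleftrightarrow> (\<forall>x \<in> set I. 0 < x)"

definition total_size :: "inst \<Rightarrow> nat set \<Rightarrow> real" where
  "total_size I A = (\<Sum>i\<in>A. I ! i)"

definition OPT :: "inst \<Rightarrow> real" where
  "OPT I = Max {total_size I A | A. A \<subseteq> {..<length I} \<and> total_size I A \<le> 1}"

(* An algorithm with advice maps an advice string and the list of sizes revealed
   so far to its current packing.  Not knowing the future items, nor their number,
   is expressed by the packing being a function of the revealed prefix only. *)
type_synonym advice = "bool list"
type_synonym alg = "advice \<Rightarrow> inst \<Rightarrow> nat set"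

(* The rules of the game have to be obeyed for every advice string, not only for
   the one supplied by the advisor. *)
definition online_alg :: "alg \<Rightarrow> bool" where
  "online_alg alg \<longleftrightarrow>
     (\<forall>w I. valid_inst I \<longrightarrow>
        alg w [] = {} \<and>
        (\<forall>i < length I.
           alg w (take (Suc i) I) \<subseteq> alg w (take i I) \<union> {i} \<and>
           total_size I (alg w (take (Suc i) I)) \<le> 1))"

definition gain :: "alg \<Rightarrow> advice \<Rightarrow> inst \<Rightarrow> real" where
  "gain alg w I = total_size I (alg w I)"

type_synonym advisor = "inst \<Rightarrow> advice"

definition uses_advice_bits :: "advisor \<Rightarrow> nat \<Rightarrow> bool" where
  "uses_advice_bits orc b \<longleftrightarrow> (\<forall>I. valid_inst I \<longrightarrow> length (orc I) = b)"

(* OPT / ALG \<le> \<rho> in product form: with x / 0 = 0 the quotient would accept an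
   algorithm of gain 0 on every instance.  If OPT I = 0 (no item fits), the
   condition holds trivially. *)
definition strictly_competitive :: "alg \<Rightarrow> advisor \<Rightarrow> real \<Rightarrow> bool" where
  "strictly_competitive alg orc \<rho> \<longleftrightarrow>
     (\<forall>I. valid_inst I \<longrightarrow> OPT I \<le> \<rho> * gain alg (orc I) I)"

end

theory Submission
  imports Defs
begin

text \<open>
  A packing of size in \<open>[3/4, 1]\<close> is good enough, so every algorithm seizes one as soon as it can and
  then keeps it.  Until then all items of size at most \<open>1/4\<close> are packed: if they overflow, removing
  them one by one produces a good packing.  Among the other items the two advice bits select a class
  (sizes above \<open>1/2\<close>, of which one item is kept, or sizes in \<open>(1/4, 1/2]\<close>, of which two are kept)
  and whether the largest or the smallest items of the class are kept; these always fit.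

  If the optimal solution contains a big and a middle item, keeping the smallest items of the class
  of the one that arrives first leaves room for the other one, and together they exceed \<open>3/4\<close>.
  Likewise, keeping the two smallest middle items leaves room for the last one of three middle items
  of the optimum.  In all other cases the optimum uses at most one big item or at most two middle
  items, and keeping the largest items of that class is optimal.
\<close>

section \<open>Keeping the k best elements of a growing set\<close>

definition keeps_top :: "nat \<Rightarrow> (nat \<Rightarrow> real) \<Rightarrow> nat set \<Rightarrow> nat set \<Rightarrow> bool" where
  "keeps_top k f C M \<longleftrightarrow>
     M \<subseteq> C \<and> card M \<le> k \<and> (\<forall>j \<in> C - M. card M = k \<and> (\<forall>m \<in> M. f j \<le> f m))"

text \<open>When all \<open>k\<close> places are taken, a minimiser \<open>d\<close> of
  \<open>f\<close> on \<open>insert i M\<close> is dropped. Elements discarded earlier are no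
  obstacle: if \<open>i\<close> survives, then \<open>d\<close> lies in \<open>M\<close>, so a
  discarded \<open>j\<close> satisfies \<open>f j\<close> \<le> \<open>f d\<close> \<le>
  \<open>f i\<close>. Hence nothing outside \<open>insert i M\<close> is ever asked for, as an
  online algorithm requires.\<close>

lemma keeps_top_insert:
  assumes "finite C" "k > 0" "keeps_top k f C M" "i \<notin> C"
  shows "\<exists>M' \<subseteq> insert i M. keeps_top k f (insert i C) M'"
proof (cases "card M < k")
  case True
  then have "M = C" using assms(3) unfolding keeps_top_def by blast
  then have "keeps_top k f (insert i C) (insert i M)"
    using True assms unfolding keeps_top_def by auto
  then show ?thesis by blast
next
  case False
  have M: "M \<subseteq> C" "card M = k" using False assms(3) unfolding keeps_top_def by auto
  have fin: "finite (insert i M)" using M assms(1) finite_subset by auto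
  obtain d where d: "d \<in> insert i M" "\<And>m. m \<in> insert i M \<Longrightarrow> f d \<le> f m"
  proof -
    have "Min (f ` insert i M) \<in> f ` insert i M" using fin by (intro Min_in) auto
    then obtain d where "d \<in> insert i M" "f d = Min (f ` insert i M)" by (metis imageE)
    then show ?thesis using that fin by (metis Min_le finite_imageI imageI)
  qed
  have "card (insert i M - {d}) = k"
    using fin d(1) M assms(4) by (subst card_Diff_singleton) (auto simp: card_insert_if)
  moreover have "f j \<le> f m" if "j \<in> insert i C - (insert i M - {d})" "m \<in> insert i M - {d}" for j m
  proof (cases "j = d")
    case True
    then show ?thesis using d that by auto
  next
    case False
    then have j: "j \<in> C - M" using that by auto
    then have le: "f j \<le> f m" if "m \<in> M" for m
      using assms(3) that unfolding keeps_top_def by blast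
    show ?thesis
    proof (cases "m = i")
      case True
      then have "d \<in> M" using that(2) d(1) by auto
      then show ?thesis using le[of d] d(2)[of m] True by auto
    qed (use le that in auto)
  qed
  ultimately have "keeps_top k f (insert i C) (insert i M - {d})"
    using M unfolding keeps_top_def by auto
  then show ?thesis by (intro exI[of _ "insert i M - {d}"]) simp
qed

lemma keeps_top_witness:
  assumes "k > 0" "keeps_top k f C M" "x \<in> C"
  obtains m where "m \<in> M" "f x \<le> f m"
proof (cases "x \<in> M")
  case False
  then have "card M = k" "\<And>m. m \<in> M \<Longrightarrow> f x \<le> f m"
    using assms unfolding keeps_top_def by auto
  moreover from this assms(1) obtain m where "m \<in> M" by fastforce
  ultimately show ?thesis using that by blast
qed (use that in auto)

lemma keeps_top_card:
  assumes "finite C" "keeps_top k f C M" "B \<subseteq> C" "card B = k"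
  shows "card M = k"
proof (cases "C \<subseteq> M")
  case True
  then have "M = C" "card M \<le> k" using assms(2) unfolding keeps_top_def by auto
  then show ?thesis using card_mono[OF assms(1,3)] assms(4) by simp
qed (use assms(2) in \<open>auto simp: keeps_top_def\<close>)

text \<open>Exchange argument with the threshold \<open>c\<close>, the best value in
  \<open>B - M\<close>: every element of \<open>B - M\<close> has value at most \<open>c\<close>,
  every element of \<open>M - B\<close> at least \<open>c\<close>. If \<open>B\<close> has exactly
  \<open>k\<close> elements, the two differences are equally large and the sign of \<open>f\<close>
  does not matter, which admits negated sizes. If \<open>B\<close> may be smaller, \<open>c\<close>
  must be nonnegative.\<close>

lemma keeps_top_sum:
  assumes "finite C" "keeps_top k f C M" "B \<subseteq> C"
    and card: "card B = k \<or> card B \<le> k \<and> (\<forall>x \<in> C. 0 \<le> f x)"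
  shows "sum f B \<le> sum f M"
proof (cases "B \<subseteq> M")
  case True
  have M: "M \<subseteq> C" "card M \<le> k" using assms(2) unfolding keeps_top_def by auto
  then have fin: "finite M" using assms(1) finite_subset by auto
  show ?thesis using card
  proof
    assume "card B = k"
    then have "B = M" using True fin M(2) by (intro card_seteq) auto
    then show ?thesis by simp
  next
    assume "card B \<le> k \<and> (\<forall>x \<in> C. 0 \<le> f x)"
    then show ?thesis using True fin M by (intro sum_mono2) auto
  qed
next
  case False
  have M: "M \<subseteq> C" "card M = k" using False assms(2,3) unfolding keeps_top_def by auto
  have fin: "finite M" "finite B" using assms M finite_subset by auto
  define c where "c = Max (f ` (B - M))"
  have ne: "finite (f ` (B - M))" "f ` (B - M) \<noteq> {}" using fin False by auto
  have up: "f b \<le> c" if "b \<in> B - M" for b using that fin unfolding c_def by simp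
  obtain b where b: "b \<in> B - M" "c = f b" using Max_in[OF ne] unfolding c_def by auto
  have low: "c \<le> f m" if "m \<in> M - B" for m
    using that b assms(2,3) unfolding keeps_top_def by auto
  have cards: "card (B - M) + card (B \<inter> M) = card B" "card (M - B) + card (B \<inter> M) = card M"
    using card_Int_Diff[OF fin(2), of M] card_Int_Diff[OF fin(1), of B] by (simp_all add: Int_commute)
  have "sum f (B - M) \<le> real (card (B - M)) * c" using up by (intro sum_bounded_above) auto
  also have "\<dots> \<le> real (card (M - B)) * c" using card
  proof
    assume "card B = k"
    then have "card (B - M) = card (M - B)" using cards M(2) by simp
    then show ?thesis by simp
  next
    assume "card B \<le> k \<and> (\<forall>x \<in> C. 0 \<le> f x)"
    then show ?thesis using cards M(2) b assms(3) by (intro mult_right_mono) auto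
  qed
  also have "\<dots> \<le> sum f (M - B)" using low by (intro sum_bounded_below) auto
  finally have "sum f (B - M) \<le> sum f (M - B)" .
  moreover have "sum f B = sum f (B \<inter> M) + sum f (B - M)" "sum f M = sum f (B \<inter> M) + sum f (M - B)"
    using sum.Int_Diff[OF fin(2), of f M] sum.Int_Diff[OF fin(1), of f B]
    by (simp_all add: Int_commute)
  ultimately show ?thesis by simp
qed

section \<open>Sizes of packings and the good interval\<close>

lemma total_size_snoc:
  "A \<subseteq> {..<length I} \<Longrightarrow> total_size (I @ [x]) A = total_size I A"
  unfolding total_size_def by (intro sum.cong) (auto simp: nth_append)

lemma total_size_take:
  "A \<subseteq> {..<n} \<Longrightarrow> total_size (take n I) A = total_size I A"
  unfolding total_size_def by (intro sum.cong) auto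

lemma total_size_Un:
  "finite A \<Longrightarrow> finite B \<Longrightarrow> A \<inter> B = {} \<Longrightarrow> total_size I (A \<union> B) = total_size I A + total_size I B"
  unfolding total_size_def by (rule sum.union_disjoint)

lemma total_size_mono:
  assumes "valid_inst I" "A \<subseteq> B" "B \<subseteq> {..<length I}"
  shows "total_size I A \<le> total_size I B"
  unfolding total_size_def using assms finite_subset[OF assms(3)]
  by (intro sum_mono2) (auto simp: valid_inst_def intro!: less_imp_le)

definition good :: "inst \<Rightarrow> nat set \<Rightarrow> bool" where
  "good I B \<longleftrightarrow> 3/4 \<le> total_size I B \<and> total_size I B \<le> 1"

text \<open>Dropping one small item lowers the size by at most 1/4, the length of the good interval.
  A descent that starts at 3/4 or above and ends with \<open>M\<close> at 1 or below therefore
  cannot jump over the interval.\<close>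

lemma shed_small_items:
  assumes "finite S" "finite M" "M \<inter> S = {}" "\<And>s. s \<in> S \<Longrightarrow> I ! s \<le> 1/4"
    and "total_size I M \<le> 1" "3/4 \<le> total_size I (M \<union> S)"
  shows "\<exists>B \<subseteq> M \<union> S. good I B"
  using assms
proof (induction S rule: finite_induct)
  case empty
  then show ?case unfolding good_def by auto
next
  case (insert s S)
  have "M \<union> insert s S = insert s (M \<union> S)" by simp
  then have eq: "total_size I (M \<union> insert s S) = I ! s + total_size I (M \<union> S)"
    using insert unfolding total_size_def by simp
  show ?case
  proof (cases "total_size I (M \<union> insert s S) \<le> 1")
    case True
    then show ?thesis using insert.prems unfolding good_def by blast
  next
    case False
    then have "3/4 \<le> total_size I (M \<union> S)" using eq insert.prems(3)[of s] by simp
    then obtain B where "B \<subseteq> M \<union> S" "good I B" using insert by auto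
    then show ?thesis by blast
  qed
qed

section \<open>The algorithm and its legality\<close>

definition small_items :: "inst \<Rightarrow> nat set" where
  "small_items I = {j. j < length I \<and> I ! j \<le> 1/4}"

text \<open>Items exceeding the capacity belong to neither class and are not small, so a regular
  packing never contains one.\<close>

definition item_class :: "bool \<Rightarrow> inst \<Rightarrow> nat set" where
  "item_class big I = {j. j < length I \<and>
     (if big then 1/2 < I ! j \<and> I ! j \<le> 1 else 1/4 < I ! j \<and> I ! j \<le> 1/2)}"

definition slots :: "bool \<Rightarrow> nat" where
  "slots big = (if big then 1 else 2)"

text \<open>Negating the sizes lets the same relation \<open>keeps_top\<close> describe keeping the
  smallest items.\<close>

definition preference :: "bool \<Rightarrow> inst \<Rightarrow> nat \<Rightarrow> real" where
  "preference largest I j = (if largest then I ! j else - I ! j)"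

text \<open>The first bit selects the class, the second the end of the size order. On words shorter
  than two bits \<open>nth\<close> still yields some fixed Boolean values, so the algorithm is legal
  for every word, as \<open>online_alg\<close> demands.\<close>

definition regular :: "advice \<Rightarrow> inst \<Rightarrow> nat set \<Rightarrow> bool" where
  "regular w I A \<longleftrightarrow> total_size I A \<le> 1 \<and>
     (\<exists>M. keeps_top (slots (w ! 0)) (preference (w ! 1) I) (item_class (w ! 0) I) M \<and>
          A = small_items I \<union> M)"

text \<open>The second alternative records that no good packing was within reach; the analysis draws
  its contradictions from this clause. Once \<open>A\<close> is good, \<open>A\<close> itself rules
  the alternative out, so goodness is never lost.\<close>

definition move :: "advice \<Rightarrow> inst \<Rightarrow> real \<Rightarrow> nat set \<Rightarrow> nat set \<Rightarrow> bool" where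
  "move w I x A B \<longleftrightarrow> B \<subseteq> insert (length I) A \<and>
     (good (I @ [x]) B \<or>
      regular w (I @ [x]) B \<and> (\<forall>B' \<subseteq> insert (length I) A. \<not> good (I @ [x]) B'))"

text \<open>With the latest item at the head, structural recursion follows the order of arrival.
  Each packing is chosen from the previous packing and the revealed items alone; the choice is
  meaningful once a move is known to exist.\<close>

fun rev_packing :: "advice \<Rightarrow> inst \<Rightarrow> nat set" where
  "rev_packing w [] = {}"
| "rev_packing w (x # xs) = (SOME B. move w (rev xs) x (rev_packing w xs) B)"

definition seize_or_rank :: alg where
  "seize_or_rank w I = rev_packing w (rev I)"

lemma seize_or_rank_Nil [simp]: "seize_or_rank w [] = {}"
  by (simp add: seize_or_rank_def)

lemma seize_or_rank_snoc: "seize_or_rank w (I @ [x]) = (SOME B. move w I x (seize_or_rank w I) B)"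
  by (simp add: seize_or_rank_def)

lemma slots_pos: "slots big > 0"
  by (simp add: slots_def)

lemma finite_small_items [simp]: "finite (small_items I)"
  and finite_item_class [simp]: "finite (item_class big I)"
  by (auto simp: small_items_def item_class_def)

lemma small_items_Int_item_class: "small_items I \<inter> item_class big I = {}"
  by (auto simp: small_items_def item_class_def split: if_splits)

lemma slots_fit:
  assumes "M \<subseteq> item_class big I" "card M \<le> slots big"
  shows "total_size I M \<le> 1"
proof -
  have "total_size I M \<le> real (card M) * (1 / real (slots big))"
    unfolding total_size_def using assms(1)
    by (intro sum_bounded_above) (auto simp: item_class_def slots_def split: if_splits)
  also have "\<dots> \<le> real (slots big) * (1 / real (slots big))"
    using assms(2) by (intro mult_right_mono) auto
  also have "\<dots> = 1" using slots_pos[of big] by simp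
  finally show ?thesis .
qed

lemma small_items_snoc: "small_items (I @ [x]) \<subseteq> insert (length I) (small_items I)"
  by (auto simp: small_items_def nth_append split: if_splits)

lemma item_class_snoc:
  "item_class big (I @ [x]) = item_class big I \<or>
   item_class big (I @ [x]) = insert (length I) (item_class big I)"
  by (auto simp: item_class_def nth_append less_Suc_eq)

lemma keeps_top_snoc:
  assumes "keeps_top k (preference largest I) (item_class big I) M"
  shows "keeps_top k (preference largest (I @ [x])) (item_class big I) M"
proof -
  have "preference largest (I @ [x]) j = preference largest I j" if "j \<in> item_class big I" for j
    using that by (auto simp: preference_def item_class_def nth_append)
  then show ?thesis using assms unfolding keeps_top_def by (auto simp: subset_iff)
qed

text \<open>If no good packing is in reach, update the kept class items and pack all small items
  with them. The class items alone fit, so an overflow could be shed down to a good packing, and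
  that packing would have been in reach.\<close>

lemma move_exists:
  assumes "regular w I A"
  shows "\<exists>B. move w I x A B"
proof (cases "\<exists>B \<subseteq> insert (length I) A. good (I @ [x]) B")
  case True
  then show ?thesis unfolding move_def by blast
next
  case False
  let ?J = "I @ [x]" and ?k = "slots (w ! 0)"
  let ?f = "preference (w ! 1) ?J"
  obtain M where M: "keeps_top ?k (preference (w ! 1) I) (item_class (w ! 0) I) M"
    "A = small_items I \<union> M" using assms unfolding regular_def by blast
  note M' = keeps_top_snoc[OF M(1), of x]
  have "length I \<notin> item_class (w ! 0) I" by (simp add: item_class_def)
  then obtain N where N: "N \<subseteq> insert (length I) M" "keeps_top ?k ?f (item_class (w ! 0) ?J) N"
    using keeps_top_insert[OF finite_item_class slots_pos M'] M' item_class_snoc[of "w ! 0" I x]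
    by (metis subset_insertI)
  let ?B = "small_items ?J \<union> N"
  have sub: "?B \<subseteq> insert (length I) A" using N M(2) small_items_snoc[of I x] by blast
  have N': "N \<subseteq> item_class (w ! 0) ?J" "card N \<le> ?k" using N(2) unfolding keeps_top_def by auto
  have "total_size ?J ?B \<le> 1"
  proof (rule ccontr)
    assume "\<not> total_size ?J ?B \<le> 1"
    then have "\<exists>B \<subseteq> N \<union> small_items ?J. good ?J B"
      using N' slots_fit[OF N'] small_items_Int_item_class[of ?J "w ! 0"]
      by (intro shed_small_items)
        (auto simp: Un_commute small_items_def intro: finite_subset[OF _ finite_item_class])
    then show False using False sub by blast
  qed
  then have "regular w ?J ?B" using N(2) unfolding regular_def by blast
  then show ?thesis using sub False unfolding move_def by blast
qed

lemma regular_Nil: "regular w [] {}"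
  by (auto simp: regular_def keeps_top_def total_size_def small_items_def item_class_def)

lemma good_snoc: "A \<subseteq> {..<length I} \<Longrightarrow> good (I @ [x]) A \<longleftrightarrow> good I A"
  by (simp add: good_def total_size_snoc)

text \<open>The three claims need a joint induction: \<open>SOME\<close> yields a genuine move only
  if the current packing is good or regular, and this in turn is known from the preceding
  move.\<close>

lemma seize_or_rank_move:
  "seize_or_rank w I \<subseteq> {..<length I} \<and>
   (good I (seize_or_rank w I) \<or> regular w I (seize_or_rank w I)) \<and>
   move w I x (seize_or_rank w I) (seize_or_rank w (I @ [x]))"
proof (induction I arbitrary: x rule: rev_induct)
  case Nil
  have "move w [] x {} (seize_or_rank w ([] @ [x]))"
    unfolding seize_or_rank_snoc seize_or_rank_Nil
    by (rule someI_ex) (rule move_exists[OF regular_Nil])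
  then show ?case using regular_Nil by simp
next
  case (snoc y I)
  let ?A = "seize_or_rank w (I @ [y])"
  have mv: "move w I y (seize_or_rank w I) ?A" and "seize_or_rank w I \<subseteq> {..<length I}"
    using snoc by auto
  then have sub: "?A \<subseteq> {..<length (I @ [y])}" unfolding move_def by auto
  have inv: "good (I @ [y]) ?A \<or> regular w (I @ [y]) ?A" using mv unfolding move_def by auto
  then have "\<exists>B. move w (I @ [y]) x ?A B"
  proof
    assume "good (I @ [y]) ?A"
    then have "move w (I @ [y]) x ?A ?A" using good_snoc[OF sub] unfolding move_def by blast
    then show ?thesis ..
  qed (rule move_exists)
  then have "move w (I @ [y]) x ?A (seize_or_rank w ((I @ [y]) @ [x]))"
    unfolding seize_or_rank_snoc[of w "I @ [y]"] by (rule someI_ex)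
  then show ?case using sub inv by simp
qed

lemma online_seize_or_rank: "online_alg seize_or_rank"
  unfolding online_alg_def
proof (intro allI impI conjI)
  fix w :: advice and I :: inst and i
  assume i: "i < length I"
  have t: "take (Suc i) I = take i I @ [I ! i]" using i by (simp add: take_Suc_conv_app_nth)
  have "move w (take i I) (I ! i) (seize_or_rank w (take i I)) (seize_or_rank w (take (Suc i) I))"
    using seize_or_rank_move[of w "take i I" "I ! i"] t by simp
  then show "seize_or_rank w (take (Suc i) I) \<subseteq> seize_or_rank w (take i I) \<union> {i}"
    using i unfolding move_def by auto
  have sub: "seize_or_rank w (take (Suc i) I) \<subseteq> {..<Suc i}"
    and "good (take (Suc i) I) (seize_or_rank w (take (Suc i) I)) \<or>
      regular w (take (Suc i) I) (seize_or_rank w (take (Suc i) I))"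
    using seize_or_rank_move[of w "take (Suc i) I" 0] i by (simp_all add: min_absorb2)
  then have "total_size (take (Suc i) I) (seize_or_rank w (take (Suc i) I)) \<le> 1"
    unfolding good_def regular_def by auto
  then show "total_size I (seize_or_rank w (take (Suc i) I)) \<le> 1"
    using total_size_take[OF sub] by simp
qed simp

section \<open>What is known when the final packing is not good\<close>

lemma not_good_history:
  assumes "\<not> good I (seize_or_rank w I)"
  shows "regular w I (seize_or_rank w I) \<and>
    (\<forall>n < length I. regular w (take n I) (seize_or_rank w (take n I)) \<and>
      (\<forall>B \<subseteq> insert n (seize_or_rank w (take n I)). \<not> good I B))"
  using assms
proof (induction I rule: rev_induct)
  case Nil
  then show ?case by (simp add: regular_Nil)
next
  case (snoc x I)
  let ?A = "seize_or_rank w I"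
  have sub: "?A \<subseteq> {..<length I}" and mv: "move w I x ?A (seize_or_rank w (I @ [x]))"
    using seize_or_rank_move by auto
  have reg: "regular w (I @ [x]) (seize_or_rank w (I @ [x]))"
    and none: "\<And>B. B \<subseteq> insert (length I) ?A \<Longrightarrow> \<not> good (I @ [x]) B"
    using mv snoc.prems unfolding move_def by blast+
  \<comment> \<open>Failure propagates backwards: a good earlier packing would itself be a good
    packing in reach when \<open>x\<close> arrives.\<close>
  have "\<not> good I ?A" using none[of ?A] good_snoc[OF sub] by blast
  note IH = snoc.IH[OF this]
  have "regular w (take n (I @ [x])) (seize_or_rank w (take n (I @ [x]))) \<and>
      (\<forall>B \<subseteq> insert n (seize_or_rank w (take n (I @ [x]))). \<not> good (I @ [x]) B)"
    if n: "n < length (I @ [x])" for n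
  proof (cases "n = length I")
    case True
    then show ?thesis using IH none by simp
  next
    case False
    then have n: "n < length I" using n by simp
    moreover have "B \<subseteq> {..<length I}" if "B \<subseteq> insert n (seize_or_rank w (take n I))" for B
      using that n seize_or_rank_move[of w "take n I"] by fastforce
    ultimately show ?thesis using IH good_snoc[of _ I x] by auto
  qed
  then show ?case using reg by blast
qed

text \<open>The history cut off just before a chosen item \<open>n\<close> arrives, with the ranking
  expressed in \<open>I\<close> instead of the prefix. It reduces a contradiction to finding a good
  set made of \<open>n\<close> and kept class items.\<close>

lemma not_good_kept:
  assumes "\<not> good I (seize_or_rank [big, largest] I)" "n < length I"
  obtains M where "M \<subseteq> {..<n}"
    "keeps_top (slots big) (preference largest I) {j \<in> item_class big I. j < n} M"
    "\<And>B. B \<subseteq> insert n M \<Longrightarrow> \<not> good I B"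
proof -
  let ?A = "seize_or_rank [big, largest] (take n I)"
  have "regular [big, largest] (take n I) ?A"
    and none: "\<And>B. B \<subseteq> insert n ?A \<Longrightarrow> \<not> good I B"
    using not_good_history[OF assms(1)] assms(2) by blast+
  then obtain M where M: "keeps_top (slots big) (preference largest (take n I))
      (item_class big (take n I)) M" and A: "?A = small_items (take n I) \<union> M"
    unfolding regular_def by auto
  have "item_class big (take n I) = {j \<in> item_class big I. j < n}"
    using assms(2) by (auto simp: item_class_def)
  then have "keeps_top (slots big) (preference largest I) {j \<in> item_class big I. j < n} M"
    using M unfolding keeps_top_def preference_def by (auto simp: subset_iff)
  moreover from this have "M \<subseteq> {..<n}" unfolding keeps_top_def by auto
  moreover have "\<not> good I B" if "B \<subseteq> insert n M" for B
    by (rule none) (use that A in auto)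
  ultimately show ?thesis by (intro that)
qed

section \<open>Patterns of items that force a good packing\<close>

lemma good_if_mixed_pair:
  assumes "valid_inst I" "x \<in> item_class big I" "y \<in> item_class (\<not> big) I" "x < y"
    and fit: "I ! x + I ! y \<le> 1"
  shows "good I (seize_or_rank [big, False] I)"
proof (rule ccontr)
  assume bad: "\<not> good I (seize_or_rank [big, False] I)"
  have y: "y < length I" using assms(3) by (simp add: item_class_def)
  obtain M where M: "M \<subseteq> {..<y}"
    "keeps_top (slots big) (preference False I) {j \<in> item_class big I. j < y} M"
    "\<And>B. B \<subseteq> insert y M \<Longrightarrow> \<not> good I B"
    by (rule not_good_kept[OF bad y]) blast
  obtain m where m: "m \<in> M" "preference False I x \<le> preference False I m"
    using keeps_top_witness[OF slots_pos M(2)] assms(2,4) by blast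
  have "m \<in> item_class big I" "m \<noteq> y" using m M unfolding keeps_top_def by auto
  \<comment> \<open>Preferences are negated sizes, so \<open>m\<close> is no larger than
    \<open>x\<close> and fits together with \<open>y\<close>. The two lie in different classes, so
    one exceeds 1/2 and the other 1/4.\<close>
  then have "good I {m, y}"
    using m(2) assms(3) fit
    by (cases big) (auto simp: good_def total_size_def preference_def item_class_def)
  then show False using M(3)[of "{m, y}"] m(1) by simp
qed

lemma good_if_triple:
  assumes "T \<subseteq> item_class False I" "card T = 3" "total_size I T \<le> 1"
  shows "good I (seize_or_rank [False, False] I)"
proof (rule ccontr)
  assume bad: "\<not> good I (seize_or_rank [False, False] I)"
  have fin: "finite T" using assms(2) by (simp add: card_ge_0_finite)
  \<comment> \<open>Indices are arrival times: \<open>r\<close> is the last of the three items, and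
    the other two were candidates for the two slots before it arrived.\<close>
  define r where "r = Max T"
  have r: "r \<in> T" unfolding r_def using fin assms(2) by (intro Max_in) auto
  have "t < r" if "t \<in> T - {r}" for t
    using that fin by (metis DiffE Max_ge insertI1 le_neq_implies_less r_def)
  then have T: "T - {r} \<subseteq> {j \<in> item_class False I. j < r}" using assms(1) by auto
  have cT: "card (T - {r}) = slots False" using r fin assms(2) by (simp add: slots_def)
  have len: "r < length I" using r assms(1) by (auto simp: item_class_def)
  obtain M where M: "M \<subseteq> {..<r}"
    "keeps_top (slots False) (preference False I) {j \<in> item_class False I. j < r} M"
    "\<And>B. B \<subseteq> insert r M \<Longrightarrow> \<not> good I B"
    by (rule not_good_kept[OF bad len]) blast
  \<comment> \<open>Both slots must be occupied, since the lower bound 3/4 comes from three items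
    larger than 1/4.\<close>
  have cM: "card M = 2" using keeps_top_card[OF _ M(2) T cT] by (simp add: slots_def)
  have finM: "finite M" using M(1) finite_subset by blast
  \<comment> \<open>The preferences are negative here, so \<open>keeps_top_sum\<close> is applied
    through its exact cardinality alternative; undoing the negation reverses the inequality.\<close>
  have sumM: "total_size I M \<le> total_size I (T - {r})"
    using keeps_top_sum[OF _ M(2) T disjI1[OF cT]]
    by (simp add: total_size_def preference_def sum_negf)
  have add: "total_size I (insert r M) = I ! r + total_size I M"
    using finM M(1) unfolding total_size_def by (intro sum.insert) auto
  have "total_size I T = I ! r + total_size I (T - {r})"
    unfolding total_size_def using fin r by (rule sum.remove)
  then have "total_size I (insert r M) \<le> 1" using add sumM assms(3) by simp
  moreover have "real (card M) * (1/4) \<le> total_size I M"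
    unfolding total_size_def using M(2)
    by (intro sum_bounded_below) (auto simp: keeps_top_def item_class_def)
  then have "3/4 \<le> total_size I (insert r M)"
    using add cM r assms(1) by (auto simp: item_class_def)
  ultimately show False using M(3)[of "insert r M"] unfolding good_def by blast
qed

section \<open>The remaining instances and the choice of advice\<close>

lemma gain_if_one_class:
  assumes "valid_inst I" "S \<subseteq> small_items I \<union> item_class big I"
    and card: "card (S \<inter> item_class big I) \<le> slots big"
    and bad: "\<not> good I (seize_or_rank [big, True] I)"
  shows "total_size I S \<le> gain seize_or_rank [big, True] I"
proof -
  let ?C = "item_class big I"
  obtain M where M: "keeps_top (slots big) (preference True I) ?C M"
    "seize_or_rank [big, True] I = small_items I \<union> M"
    using not_good_history[OF bad] unfolding regular_def by auto
  have sub: "M \<subseteq> ?C" using M(1) unfolding keeps_top_def by simp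
  have pos: "\<forall>x \<in> ?C. 0 \<le> preference True I x"
    by (auto simp: item_class_def preference_def split: if_splits)
  have "total_size I (S \<inter> ?C) \<le> total_size I M"
    using keeps_top_sum[OF _ M(1), of "S \<inter> ?C"] card pos
    by (simp add: total_size_def preference_def)
  moreover have "total_size I (S \<inter> small_items I) \<le> total_size I (small_items I)"
    by (intro total_size_mono assms) (auto simp: small_items_def)
  moreover have "total_size I S = total_size I (S \<inter> small_items I) + total_size I (S \<inter> ?C)"
    using assms(2) small_items_Int_item_class[of I big]
    by (subst total_size_Un[symmetric]) (auto intro: arg_cong[where f = "total_size I"])
  moreover have "total_size I (small_items I \<union> M) = total_size I (small_items I) + total_size I M"
    using small_items_Int_item_class[of I big] sub finite_subset[OF sub]
    by (intro total_size_Un) auto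
  ultimately show ?thesis using M(2) by (simp add: gain_def)
qed

text \<open>A word that reaches a good packing gains at least 3/4 against at most 1. If all four
  words fail, the failures with smallest-first ranking exclude mixed pairs and triples of middle
  items from \<open>S\<close>. Then \<open>S\<close> consists of small items and items of one class
  that respect its slots, and ranking that class largest-first gains at least the size of
  \<open>S\<close>.\<close>

lemma advice_exists:
  assumes I: "valid_inst I" and S: "S \<subseteq> {..<length I}" "total_size I S \<le> 1"
  shows "\<exists>big largest. total_size I S \<le> 4/3 * gain seize_or_rank [big, largest] I"
proof (cases "\<exists>big largest. good I (seize_or_rank [big, largest] I)")
  case True
  then obtain big largest where "good I (seize_or_rank [big, largest] I)" by blast
  then have "total_size I S \<le> 4/3 * gain seize_or_rank [big, largest] I"
    using S(2) by (simp add: good_def gain_def)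
  then show ?thesis by blast
next
  case False
  then have bad: "\<And>big largest. \<not> good I (seize_or_rank [big, largest] I)" by blast
  let ?B = "item_class True I" and ?H = "item_class False I"
  have fin: "finite S" using S(1) finite_subset by blast
  have part: "total_size I T \<le> 1" if "T \<subseteq> S" for T
    using total_size_mono[OF I that S(1)] S(2) by simp
  have pair: "I ! i + I ! j \<le> 1" if "i \<in> S" "j \<in> S" "i \<noteq> j" for i j
    using part[of "{i, j}"] that by (simp add: total_size_def)
  have cover: "S \<subseteq> small_items I \<union> (?B \<union> ?H)"
  proof
    fix i assume "i \<in> S"
    then have "i < length I" "I ! i \<le> 1" using S(1) part[of "{i}"] by (auto simp: total_size_def)
    then show "i \<in> small_items I \<union> (?B \<union> ?H)" by (auto simp: small_items_def item_class_def)
  qed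
  have "\<exists>big. S \<subseteq> small_items I \<union> item_class big I \<and> card (S \<inter> item_class big I) \<le> slots big"
  proof (cases "S \<inter> ?B = {}")
    case True
    have "card (S \<inter> ?H) \<le> 2"
    proof (rule ccontr)
      assume "\<not> card (S \<inter> ?H) \<le> 2"
      then have "3 \<le> card (S \<inter> ?H)" by simp
      then obtain T where "T \<subseteq> S \<inter> ?H" "card T = 3" by (rule obtain_subset_with_card_n) auto
      then show False using good_if_triple[of T I] part[of T] bad by auto
    qed
    then have "S \<subseteq> small_items I \<union> ?H \<and> card (S \<inter> ?H) \<le> slots False"
      using True cover by (auto simp: slots_def)
    then show ?thesis by blast
  next
    case False
    then obtain b where b: "b \<in> S" "b \<in> ?B" by blast
    have "S \<inter> ?B \<subseteq> {b}"
    proof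
      fix c assume c: "c \<in> S \<inter> ?B"
      then have "\<not> I ! b + I ! c \<le> 1" using b by (auto simp: item_class_def)
      then show "c \<in> {b}" using pair[of b c] b c by auto
    qed
    then have "card (S \<inter> ?B) \<le> 1" using card_mono[of "{b}"] by simp
    moreover have "S \<inter> ?H = {}"
    proof (rule ccontr)
      assume "S \<inter> ?H \<noteq> {}"
      then obtain a where a: "a \<in> S" "a \<in> ?H" by blast
      have "a \<noteq> b" using a b by (auto simp: item_class_def)
      \<comment> \<open>The class of the item that arrives first determines the first advice bit;
        the other item then plays the role of the arriving one.\<close>
      then show False
        using good_if_mixed_pair[OF I, of a False b] good_if_mixed_pair[OF I, of b True a]
          a b pair[of a b] pair[of b a] bad by (cases "a < b") auto
    qed
    ultimately have "S \<subseteq> small_items I \<union> ?B \<and> card (S \<inter> ?B) \<le> slots True"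
      using cover by (auto simp: slots_def)
    then show ?thesis by blast
  qed
  then obtain big where "S \<subseteq> small_items I \<union> item_class big I"
    "card (S \<inter> item_class big I) \<le> slots big" by blast
  then have le: "total_size I S \<le> gain seize_or_rank [big, True] I"
    using gain_if_one_class[OF I _ _ bad] by blast
  moreover have "0 \<le> gain seize_or_rank [big, True] I"
    using total_size_mono[OF I empty_subsetI, of "seize_or_rank [big, True] I"]
      seize_or_rank_move[of "[big, True]" I]
    by (simp add: gain_def) (simp add: total_size_def)
  ultimately have "total_size I S \<le> 4/3 * gain seize_or_rank [big, True] I" by simp
  then show ?thesis by blast
qed

lemma OPT_attained:
  obtains S where "S \<subseteq> {..<length I}" "total_size I S \<le> 1" "OPT I = total_size I S"
proof -
  let ?F = "{total_size I A | A. A \<subseteq> {..<length I} \<and> total_size I A \<le> 1}"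
  have "?F \<subseteq> total_size I ` Pow {..<length I}" by blast
  then have "finite ?F" by (rule finite_subset) simp
  moreover have "total_size I {} \<in> ?F" by (force simp: total_size_def)
  ultimately have "OPT I \<in> ?F" unfolding OPT_def by (intro Max_in) auto
  then show ?thesis using that by blast
qed

theorem theorem7:
  "\<exists>(alg :: alg) (orc :: advisor).
     online_alg alg \<and> uses_advice_bits orc 2 \<and> strictly_competitive alg orc (4 / 3)"
proof -
  \<comment> \<open>A word of length two is provided for every list, with an arbitrary one for
    invalid instances, so that \<open>choice\<close> yields a total advisor.\<close>
  have "\<exists>w. length w = 2 \<and> (valid_inst I \<longrightarrow> OPT I \<le> 4/3 * gain seize_or_rank w I)" for I
  proof (cases "valid_inst I")
    case True
    obtain S where "S \<subseteq> {..<length I}" "total_size I S \<le> 1" "OPT I = total_size I S"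
      by (rule OPT_attained)
    then obtain big largest where "OPT I \<le> 4/3 * gain seize_or_rank [big, largest] I"
      using advice_exists[OF True] by metis
    then show ?thesis by (intro exI[of _ "[big, largest]"]) simp
  next
    case False
    then show ?thesis by (intro exI[of _ "[True, True]"]) simp
  qed
  then have "\<forall>I. \<exists>w. length w = 2 \<and> (valid_inst I \<longrightarrow> OPT I \<le> 4/3 * gain seize_or_rank w I)"
    by (rule allI)
  from choice[OF this] obtain orc :: advisor where
    "\<forall>I. length (orc I) = 2 \<and> (valid_inst I \<longrightarrow> OPT I \<le> 4/3 * gain seize_or_rank (orc I) I)"
    ..
  then have "uses_advice_bits orc 2" "strictly_competitive seize_or_rank orc (4/3)"
    unfolding uses_advice_bits_def strictly_competitive_def by auto
  then show ?thesis using online_seize_or_rank by blast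
qed

end
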